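(* Let $p$ be a prime and $\mathcal{H}=\{H_1,\dots,H_r\}$ a set of pairwise non-isomorphic order-$p$ reduced graphs. Then there exist quantum graphs $\bar{F}_1,\dots,\bar{F}_r$, each with at most $2^c$ constituents where $c$ is polynomial in the number of vertices of the graphs in $\mathcal{H}$, such that for all $i,j\in[r]$, $\hom(\bar{F}_i,H_j)\equiv1\pmod p$ if $i=j$ and $\hom(\bar{F}_i,H_j)\equiv0\pmod p$ if $i\neq j$.
   Context: Graphs are finite, undirected, may have loops, no multiple edges. $\hom(G,H)$ is the number of homomorphisms $G\to H$. A graph is order-$p$ reduced if it has no automorphism of order $p$ (non-identity automorphism $\varrho$ with $\varrho^p=\mathrm{id}$). A quantum graph is a formal finite linear combination $\bar F=\sum_{F}\beta_F F$ of pairwise non-isomorphic graphs (its constituents) with coefficients in $\mathbb{Z}_p$, and $\hom(\bar{F},H)=\sum_F\beta_F\hom(F,H)$. *)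

theory Defs
  imports
    "HOL-Number_Theory.Cong"
    "HOL-Computational_Algebra.Polynomial"
    "HOL-Combinatorics.Permutations"
    "HOL-Library.FuncSet"
    "HOL-Library.Poly_Mapping"
begin

text \<open>
  Finite undirected graphs without multiple edges. An edge is the set of its endpoints, so a loop
  at \<open>u\<close> is the singleton \<open>{u}\<close>. The graph without vertices is allowed.
\<close>

record 'a graph =
  verts :: "'a set"
  edges :: "'a set set"

definition fin_graph :: "'a graph \<Rightarrow> bool" where
  "fin_graph G \<longleftrightarrow>
     finite (verts G) \<and> (\<forall>e\<in>edges G. \<exists>u\<in>verts G. \<exists>v\<in>verts G. e = {u, v})"

text \<open>
  Homomorphisms are extensional, that is, they take the fixed value \<^const>\<open>undefined\<close> outside
  the vertex set, so that each map between the vertex sets is counted exactly once.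
\<close>

definition homs :: "'a graph \<Rightarrow> 'b graph \<Rightarrow> ('a \<Rightarrow> 'b) set" where
  "homs G H = {f \<in> verts G \<rightarrow>\<^sub>E verts H.
     \<forall>u\<in>verts G. \<forall>v\<in>verts G. {u, v} \<in> edges G \<longrightarrow> {f u, f v} \<in> edges H}"

definition hom :: "'a graph \<Rightarrow> 'b graph \<Rightarrow> nat" where
  "hom G H = card (homs G H)"

definition graph_iso :: "('a \<Rightarrow> 'b) \<Rightarrow> 'a graph \<Rightarrow> 'b graph \<Rightarrow> bool" where
  "graph_iso f G H \<longleftrightarrow> bij_betw f (verts G) (verts H) \<and>
     (\<forall>u\<in>verts G. \<forall>v\<in>verts G. {u, v} \<in> edges G \<longleftrightarrow> {f u, f v} \<in> edges H)"

definition isomorphic :: "'a graph \<Rightarrow> 'b graph \<Rightarrow> bool" where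
  "isomorphic G H \<longleftrightarrow> (\<exists>f. graph_iso f G H)"

text \<open>
  Automorphisms are extended by the identity outside the vertex set, so that the identity
  automorphism is \<^const>\<open>id\<close>.
\<close>

definition automorphism :: "('a \<Rightarrow> 'a) \<Rightarrow> 'a graph \<Rightarrow> bool" where
  "automorphism f G \<longleftrightarrow> f permutes verts G \<and> graph_iso f G G"

definition order_reduced :: "nat \<Rightarrow> 'a graph \<Rightarrow> bool" where
  "order_reduced p G \<longleftrightarrow> \<not> (\<exists>f. automorphism f G \<and> f \<noteq> id \<and> f ^^ p = id)"

text \<open>
  A quantum graph is a finitely supported coefficient function on graphs. Every finite graph is
  isomorphic to one with vertices in \<^typ>\<open>nat\<close>. An element of \<open>\<int>\<^sub>p\<close> is represented by its
  residue in \<open>{0..<p}\<close>; the constituents are the graphs with nonzero coefficient.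
\<close>

type_synonym qgraph = "nat graph \<Rightarrow>\<^sub>0 int"

definition constituents :: "qgraph \<Rightarrow> nat graph set" where
  "constituents F = Poly_Mapping.keys F"

definition quantum_graph :: "nat \<Rightarrow> qgraph \<Rightarrow> bool" where
  "quantum_graph p F \<longleftrightarrow>
     (\<forall>G\<in>constituents F. fin_graph G) \<and>
     (\<forall>G\<in>constituents F. \<forall>G'\<in>constituents F. G \<noteq> G' \<longrightarrow> \<not> isomorphic G G') \<and>
     (\<forall>G. Poly_Mapping.lookup F G \<in> {0..<int p})"

text \<open>To be read modulo \<open>p\<close>.\<close>

definition qhom :: "qgraph \<Rightarrow> 'a graph \<Rightarrow> int" where
  "qhom F H = (\<Sum>G\<in>constituents F. Poly_Mapping.lookup F G * int (hom G H))"

end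

theory Submission
  imports "HOL-Algebra.Sylow" "HOL-Algebra.Multiplicative_Group" Defs
begin

text \<open>
  Sorting homomorphisms by the partition of the vertices into fibres shows, by induction on the
  number of vertices of \<open>G\<close>, that the number \<open>inj(G, \<cdot>)\<close> of injective homomorphisms from \<open>G\<close>
  is an integer combination of functions \<open>hom(G', \<cdot>)\<close> where \<open>G'\<close> has at most as many vertices
  as \<open>G\<close>. If \<open>inj(H\<^sub>i, H\<^sub>j) \<noteq> 0\<close> and \<open>i \<noteq> j\<close>, then \<open>H\<^sub>j\<close> has more vertices and edges in total
  than \<open>H\<^sub>i\<close>, so the matrix \<open>inj(H\<^sub>i, H\<^sub>j)\<close> is triangular in a suitable order. Its diagonal
  entries are the orders of the automorphism groups, which are units modulo \<open>p\<close> by Cauchy's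
  theorem. Hence each indicator function of an \<open>H\<^sub>i\<close> is, modulo \<open>p\<close>, a combination of functions
  \<open>hom(G, \<cdot>)\<close> where \<open>G\<close> has at most \<open>N\<close> vertices, \<open>N\<close> being the largest number of vertices
  of the \<open>H\<^sub>i\<close>; up to isomorphism there are at most \<open>(N + 1) * 2^(N^2)\<close> such graphs.
\<close>

subsection \<open>Homomorphisms and isomorphisms\<close>

definition inj_homs :: "'a graph \<Rightarrow> 'b graph \<Rightarrow> ('a \<Rightarrow> 'b) set" where
  "inj_homs G H = {f \<in> homs G H. inj_on f (verts G)}"

lemma homs_edge:
  "f \<in> homs G H \<Longrightarrow> u \<in> verts G \<Longrightarrow> v \<in> verts G \<Longrightarrow> {u, v} \<in> edges G \<Longrightarrow> {f u, f v} \<in> edges H"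
  by (simp add: homs_def)

lemma homs_PiE: "f \<in> homs G H \<Longrightarrow> f \<in> verts G \<rightarrow>\<^sub>E verts H"
  by (simp add: homs_def)

lemma finite_homs: "finite (verts G) \<Longrightarrow> finite (verts H) \<Longrightarrow> finite (homs G H)"
  by (rule finite_subset[of _ "verts G \<rightarrow>\<^sub>E verts H"]) (auto simp: homs_def intro!: finite_PiE)

lemma finite_edges:
  assumes "fin_graph G" shows "finite (edges G)"
proof (rule finite_subset)
  show "edges G \<subseteq> Pow (verts G)" using assms by (auto simp: fin_graph_def)
  show "finite (Pow (verts G))" using assms by (auto simp: fin_graph_def)
qed

lemma graph_iso_inv:
  assumes "graph_iso f G G'"
  shows "graph_iso (inv_into (verts G) f) G' G"
proof -
  let ?g = "inv_into (verts G) f"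
  have b: "bij_betw f (verts G) (verts G')"
    and e: "\<And>u v. u \<in> verts G \<Longrightarrow> v \<in> verts G \<Longrightarrow> {u, v} \<in> edges G \<longleftrightarrow> {f u, f v} \<in> edges G'"
    using assms by (auto simp: graph_iso_def)
  have "?g u \<in> verts G \<and> f (?g u) = u" if "u \<in> verts G'" for u
    using that b by (metis bij_betw_imp_surj_on f_inv_into_f inv_into_into)
  then show ?thesis
    using e bij_betw_inv_into[OF b] by (simp add: graph_iso_def)
qed

lemma isomorphic_refl: "isomorphic G G"
  by (auto simp: isomorphic_def graph_iso_def intro!: exI[of _ id])

lemma isomorphic_sym: "isomorphic G G' \<Longrightarrow> isomorphic G' G"
  using graph_iso_inv by (auto simp: isomorphic_def)

lemma graph_iso_comp:
  assumes "graph_iso f G G'" "graph_iso g G' G''"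
  shows "graph_iso (g \<circ> f) G G''"
proof -
  have "f u \<in> verts G'" if "u \<in> verts G" for u
    using assms(1) that by (auto simp: graph_iso_def bij_betw_def)
  then show ?thesis
    using assms by (auto simp: graph_iso_def intro: bij_betw_trans)
qed

lemma isomorphic_trans: "isomorphic G G' \<Longrightarrow> isomorphic G' G'' \<Longrightarrow> isomorphic G G''"
  using graph_iso_comp by (fastforce simp: isomorphic_def)

lemma homs_comp_iso:
  assumes "graph_iso f G G'" "g \<in> homs G' H"
  shows "restrict (g \<circ> f) (verts G) \<in> homs G H"
proof -
  have "f u \<in> verts G'" if "u \<in> verts G" for u
    using assms that by (auto simp: graph_iso_def bij_betw_def)
  then show ?thesis
    using assms by (auto simp: homs_def graph_iso_def)
qed

lemma inj_homs_comp_iso: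
  assumes "graph_iso f G G'" "g \<in> inj_homs G' H"
  shows "restrict (g \<circ> f) (verts G) \<in> inj_homs G H"
proof -
  have "inj_on (g \<circ> f) (verts G)"
    using assms by (auto simp: graph_iso_def bij_betw_def inj_homs_def intro!: comp_inj_on)
  then show ?thesis
    using homs_comp_iso[of f G G' g H] assms by (simp add: inj_homs_def inj_on_restrict_eq)
qed

text \<open>Composition alone does not keep the value \<open>undefined\<close> outside the domain,
  so each pullback is followed by \<open>restrict\<close>. These identities make pullback along a
  bijection and along its inverse mutually inverse.\<close>

lemma restrict_comp_inv:
  assumes b: "bij_betw f A B" 
  shows "g \<in> A \<rightarrow>\<^sub>E C \<Longrightarrow> restrict (restrict (g \<circ> inv_into A f) B \<circ> f) A = g"
    and "g' \<in> B \<rightarrow>\<^sub>E C \<Longrightarrow> restrict (restrict (g' \<circ> f) A \<circ> inv_into A f) B = g'"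
proof -
  have 1: "f a \<in> B \<and> inv_into A f (f a) = a" if "a \<in> A" for a
    using b that by (auto simp: bij_betw_def)
  have 2: "inv_into A f a \<in> A \<and> f (inv_into A f a) = a" if "a \<in> B" for a
    using b that by (metis bij_betw_imp_surj_on f_inv_into_f inv_into_into)
  show "restrict (restrict (g \<circ> inv_into A f) B \<circ> f) A = g" if "g \<in> A \<rightarrow>\<^sub>E C"
    using that 1 by (intro ext) (auto simp: PiE_def extensional_def)
  show "restrict (restrict (g' \<circ> f) A \<circ> inv_into A f) B = g'" if "g' \<in> B \<rightarrow>\<^sub>E C"
    using that 2 by (intro ext) (auto simp: PiE_def extensional_def)
qed

text \<open>Precomposition with an isomorphism and with its inverse are mutually inverse and
  preserve injectivity. So a source graph may be replaced by any representative of its isomorphism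
  class.\<close>

lemma
  assumes "isomorphic G G'"
  shows hom_isomorphic: "hom G H = hom G' H"
    and card_inj_homs_isomorphic: "card (inj_homs G H) = card (inj_homs G' H)"
proof -
  from assms obtain f where f: "graph_iso f G G'" by (auto simp: isomorphic_def)
  let ?V = "verts G" and ?W = "verts G'"
  let ?i = "inv_into ?V f"
  note i = graph_iso_inv[OF f]
  have b: "bij_betw f ?V ?W" using f by (simp add: graph_iso_def)
  have inv: "restrict (restrict (g \<circ> ?i) ?W \<circ> f) ?V = g" if "g \<in> homs G H" for g
    using restrict_comp_inv(1)[OF b homs_PiE[OF that]] by simp
  have inv': "restrict (restrict (g \<circ> f) ?V \<circ> ?i) ?W = g" if "g \<in> homs G' H" for g
    using restrict_comp_inv(2)[OF b homs_PiE[OF that]] by simp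
  have "bij_betw (\<lambda>g. restrict (g \<circ> ?i) ?W) (homs G H) (homs G' H)"
    by (rule bij_betw_byWitness[where f' = "\<lambda>g. restrict (g \<circ> f) ?V"])
      (use homs_comp_iso[OF f] homs_comp_iso[OF i] inv inv' in blast)+
  then show "hom G H = hom G' H"
    by (auto simp: hom_def bij_betw_same_card)
  have "inj_homs G H \<subseteq> homs G H" "inj_homs G' H \<subseteq> homs G' H"
    by (auto simp: inj_homs_def)
  then have "bij_betw (\<lambda>g. restrict (g \<circ> ?i) ?W) (inj_homs G H) (inj_homs G' H)"
    by (intro bij_betw_byWitness[where f' = "\<lambda>g. restrict (g \<circ> f) ?V"])
      (use inj_homs_comp_iso[OF f] inj_homs_comp_iso[OF i] inv inv' in blast)+
  then show "card (inj_homs G H) = card (inj_homs G' H)"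
    by (rule bij_betw_same_card)
qed

subsection \<open>Fibres and quotients\<close>

text \<open>
  The chosen representatives depend only on the partition of \<open>V\<close> into the fibres of \<open>f\<close>, so
  partitions are encoded as a finite set of maps from \<open>V\<close> to \<open>V\<close>.
\<close>

definition ker_map :: "'a set \<Rightarrow> ('a \<Rightarrow> 'b) \<Rightarrow> 'a \<Rightarrow> 'a" where
  "ker_map V f = (\<lambda>v\<in>V. SOME u. u \<in> V \<and> f u = f v)"

lemma ker_map_props:
  assumes "v \<in> V"
  shows "ker_map V f v \<in> V" "f (ker_map V f v) = f v"
proof -
  have "\<exists>u. u \<in> V \<and> f u = f v" using assms by blast
  from someI_ex[OF this] show "ker_map V f v \<in> V" "f (ker_map V f v) = f v"
    using assms by (auto simp: ker_map_def)
qed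

lemma ker_map_eq_iff:
  assumes "u \<in> V" "v \<in> V"
  shows "ker_map V f u = ker_map V f v \<longleftrightarrow> f u = f v"
proof
  show "f u = f v" if "ker_map V f u = ker_map V f v"
    using that ker_map_props(2)[OF assms(1), of f] ker_map_props(2)[OF assms(2), of f] by metis
  show "ker_map V f u = ker_map V f v" if "f u = f v"
    unfolding ker_map_def using assms that by simp
qed

text \<open>Equal fibres give equal predicates under \<open>SOME\<close>, hence equal choices, even
  when \<open>f\<close> and \<open>g\<close> have different codomains. So \<open>ker_map V f\<close>
  is a canonical form of the partition.\<close>

lemma ker_map_cong:
  assumes "\<And>u v. u \<in> V \<Longrightarrow> v \<in> V \<Longrightarrow> f u = f v \<longleftrightarrow> g u = g v"
  shows "ker_map V f = ker_map V g"
  unfolding ker_map_def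
proof (rule restrict_ext)
  fix v assume "v \<in> V"
  then have "(u \<in> V \<and> f u = f v) = (u \<in> V \<and> g u = g v)" for u using assms by blast
  then show "(SOME u. u \<in> V \<and> f u = f v) = (SOME u. u \<in> V \<and> g u = g v)" by simp
qed

lemma ker_map_idem: "ker_map V (ker_map V f) = ker_map V f"
  by (rule ker_map_cong) (rule ker_map_eq_iff)

lemma ker_map_in_PiE: "ker_map V f \<in> V \<rightarrow>\<^sub>E V"
  using ker_map_props(1)[of _ V f] by (auto simp: ker_map_def)

text \<open>If all fibres are singletons, the choice of representatives is forced. This singles out
  the injective maps among the fibre patterns.\<close>

lemma ker_map_eq_id_iff: "ker_map V f = restrict id V \<longleftrightarrow> inj_on f V"
proof
  assume "ker_map V f = restrict id V"
  then show "inj_on f V" using ker_map_eq_iff[of _ V _ f] by (auto intro!: inj_onI)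
next
  assume "inj_on f V"
  then show "ker_map V f = restrict id V"
    using ker_map_props[of _ V f]
    by (intro ext) (auto simp: ker_map_def inj_on_def)
qed

text \<open>With \<open>k\<close> a fibre pattern, each fibre is contracted to its chosen
  representative. An edge inside a fibre becomes a loop, and edges that become parallel
  merge.\<close>

definition quotient_graph :: "'a graph \<Rightarrow> ('a \<Rightarrow> 'a) \<Rightarrow> 'a graph" where
  "quotient_graph G k = \<lparr>verts = k ` verts G, edges = (\<lambda>e. k ` e) ` edges G\<rparr>"

lemma fin_graph_quotient_graph: "fin_graph G \<Longrightarrow> fin_graph (quotient_graph G k)"
  by (fastforce simp: fin_graph_def quotient_graph_def)

lemma card_homs_ker_map:
  assumes G: "fin_graph G" and k: "ker_map (verts G) k = k"
  shows "card {f \<in> homs G H. ker_map (verts G) f = k} = card (inj_homs (quotient_graph G k) H)"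
proof -
  let ?V = "verts G"
  have kV: "k v \<in> ?V" "k (k v) = k v" if "v \<in> ?V" for v
    using ker_map_props[of v ?V k] that k by auto
  have kimg: "w \<in> ?V" "k w = w" if "w \<in> k ` ?V" for w
    using that kV by auto
  \<comment> \<open>This trades an equation between choice functions for a condition on fibres, so
    that \<open>SOME\<close> need not be unfolded.\<close>
  have ker: "ker_map ?V f = k \<longleftrightarrow> (\<forall>u\<in>?V. \<forall>v\<in>?V. f u = f v \<longleftrightarrow> k u = k v)" for f :: "_ \<Rightarrow> 'b"
  proof
    show "\<forall>u\<in>?V. \<forall>v\<in>?V. f u = f v \<longleftrightarrow> k u = k v" if "ker_map ?V f = k"
      using ker_map_eq_iff[of _ ?V _ f] that by auto
    show "ker_map ?V f = k" if "\<forall>u\<in>?V. \<forall>v\<in>?V. f u = f v \<longleftrightarrow> k u = k v"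
      using ker_map_cong[of ?V f k] that k by auto
  qed
  have up: "restrict f (k ` ?V) \<in> inj_homs (quotient_graph G k) H"
    if f: "f \<in> homs G H" and kf: "ker_map ?V f = k" for f
  proof -
    have fk: "f (k v) = f v" if "v \<in> ?V" for v
      using kf that kV ker by blast
    have "{f u, f v} \<in> edges H" if "u \<in> k ` ?V" "v \<in> k ` ?V" "{u, v} \<in> (`) k ` edges G" for u v
    proof -
      \<comment> \<open>The representatives \<open>u\<close> and \<open>v\<close> need not be
        adjacent in \<open>G\<close>; only some edge \<open>{a, b}\<close> is mapped onto
        \<open>{u, v}\<close> by \<open>k\<close>.\<close>
      from that(3) obtain e where e: "e \<in> edges G" "{u, v} = k ` e" by auto
      with G obtain a b where ab: "a \<in> ?V" "b \<in> ?V" "e = {a, b}" by (auto simp: fin_graph_def)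
      then have "{f u, f v} = f ` k ` e" using e by (metis image_insert image_empty)
      also have "\<dots> = {f a, f b}" using ab fk by auto
      finally show ?thesis using homs_edge[OF f ab(1,2)] e ab by simp
    qed
    moreover have "inj_on f (k ` ?V)"
    proof (rule inj_onI)
      fix x y assume xy: "x \<in> k ` ?V" "y \<in> k ` ?V" "f x = f y"
      then have "k x = k y" using kf ker kimg(1) by blast
      then show "x = y" using xy kimg(2) by metis
    qed
    moreover have "f w \<in> verts H" if "w \<in> k ` ?V" for w
      using homs_PiE[OF f] kimg[OF that] by auto
    ultimately show ?thesis
      by (auto simp: inj_homs_def homs_def quotient_graph_def inj_on_restrict_eq)
  qed
  have down: "restrict (g \<circ> k) ?V \<in> homs G H \<and> ker_map ?V (restrict (g \<circ> k) ?V) = k"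
    if g: "g \<in> inj_homs (quotient_graph G k) H" for g
  proof
    have gh: "g \<in> homs (quotient_graph G k) H" and gi: "inj_on g (k ` ?V)"
      using g by (auto simp: inj_homs_def quotient_graph_def)
    show "ker_map ?V (restrict (g \<circ> k) ?V) = k"
      unfolding ker using gi by (auto dest: inj_onD)
    have "{g (k u), g (k v)} \<in> edges H" if "u \<in> ?V" "v \<in> ?V" "{u, v} \<in> edges G" for u v
    proof (rule homs_edge[OF gh])
      have "k ` {u, v} \<in> (`) k ` edges G" using that(3) by blast
      then show "{k u, k v} \<in> edges (quotient_graph G k)" by (simp add: quotient_graph_def)
    qed (use that in \<open>auto simp: quotient_graph_def\<close>)
    then show "restrict (g \<circ> k) ?V \<in> homs G H"
      using homs_PiE[OF gh] by (auto simp: homs_def quotient_graph_def)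
  qed
  have "bij_betw (\<lambda>f. restrict f (k ` ?V)) {f \<in> homs G H. ker_map ?V f = k}
    (inj_homs (quotient_graph G k) H)"
  proof (rule bij_betw_byWitness[where f' = "\<lambda>g. restrict (g \<circ> k) ?V"])
    show "\<forall>f\<in>{f \<in> homs G H. ker_map ?V f = k}. restrict (restrict f (k ` ?V) \<circ> k) ?V = f"
    proof safe
      fix f assume f: "f \<in> homs G H" "k = ker_map ?V f"
      have "f (k v) = f v" if "v \<in> ?V" for v using f(2) ker_map_props[OF that] by simp
      then have "restrict (restrict f (k ` ?V) \<circ> k) ?V = f"
        using homs_PiE[OF f(1)] by (intro ext) (auto simp: PiE_def extensional_def)
      then show "restrict (restrict f (ker_map ?V f ` ?V) \<circ> ker_map ?V f) ?V = f"
        using f(2) by simp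
    qed
    show "\<forall>g\<in>inj_homs (quotient_graph G k) H. restrict (restrict (g \<circ> k) ?V) (k ` ?V) = g"
    proof
      fix g assume "g \<in> inj_homs (quotient_graph G k) H"
      then have "g \<in> k ` ?V \<rightarrow>\<^sub>E verts H" by (auto simp: inj_homs_def homs_def quotient_graph_def)
      then have "g w = undefined" if "w \<notin> k ` ?V" for w
        using that by (rule PiE_arb)
      then show "restrict (restrict (g \<circ> k) ?V) (k ` ?V) = g"
        using kV by (auto simp: fun_eq_iff restrict_def)
    qed
  qed (use up down in auto)
  then show ?thesis by (rule bij_betw_same_card)
qed

text \<open>Being a fixed point of \<open>ker_map V\<close> selects one map for each partition of
  \<open>V\<close>.\<close>

definition ker_maps :: "'a set \<Rightarrow> ('a \<Rightarrow> 'a) set" where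
  "ker_maps V = {k \<in> V \<rightarrow>\<^sub>E V. ker_map V k = k}"

text \<open>Fibre patterns realised by no homomorphism into \<open>H\<close> contribute zero. So the
  index set depends on \<open>G\<close> alone, and the same linear relation holds for every
  \<open>H\<close>.\<close>

lemma hom_eq_sum_inj_homs:
  assumes G: "fin_graph G" and H: "fin_graph H"
  shows "hom G H = (\<Sum>k\<in>ker_maps (verts G). card (inj_homs (quotient_graph G k) H))"
proof -
  let ?V = "verts G"
  have fin: "finite (homs G H)" "finite ?V"
    using G H by (auto simp: fin_graph_def intro: finite_homs)
  have finK: "finite (ker_maps ?V)"
    by (rule finite_subset[of _ "?V \<rightarrow>\<^sub>E ?V"]) (use fin in \<open>auto simp: ker_maps_def intro: finite_PiE\<close>)
  have "ker_map ?V ` homs G H \<subseteq> ker_maps ?V"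
    using ker_map_in_PiE[of ?V] ker_map_idem[of ?V] by (fastforce simp: ker_maps_def)
  from sum.group[OF fin(1) finK this, of "\<lambda>_. 1::nat"]
  have "hom G H = (\<Sum>k\<in>ker_maps ?V. card {f \<in> homs G H. ker_map ?V f = k})"
    by (simp add: hom_def)
  also have "\<dots> = (\<Sum>k\<in>ker_maps ?V. card (inj_homs (quotient_graph G k) H))"
    by (rule sum.cong) (auto simp: ker_maps_def card_homs_ker_map[OF G])
  finally show ?thesis .
qed

lemma restrict_id_in_ker_maps: "restrict id V \<in> ker_maps V"
  using ker_map_eq_id_iff[of V "restrict id V"] by (auto simp: ker_maps_def)

lemma quotient_restrict_id:
  assumes "fin_graph G"
  shows "quotient_graph G (restrict id (verts G)) = G"
proof -
  have "restrict id (verts G) ` e = e" if "e \<in> edges G" for e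
    using assms that by (auto simp: fin_graph_def)
  then show ?thesis by (simp add: quotient_graph_def)
qed

text \<open>Any pattern other than the identity merges two vertices, which drives the induction on
  the number of vertices.\<close>

lemma card_verts_quotient_less:
  assumes "finite (verts G)" "k \<in> ker_maps (verts G)" "k \<noteq> restrict id (verts G)"
  shows "card (verts (quotient_graph G k)) < card (verts G)"
proof -
  have "\<not> inj_on k (verts G)"
    using assms(2,3) ker_map_eq_id_iff[of "verts G" k] by (auto simp: ker_maps_def)
  then show ?thesis
    using assms(1) by (simp add: quotient_graph_def card_image_le pigeonhole le_neq_implies_less inj_on_iff_eq_card)
qed

subsection \<open>Automorphism groups\<close>

text \<open>Cauchy's theorem. \<open>sylow_thm\<close> does not ask that \<open>m\<close> be prime
  to \<open>p\<close>, so exponent 1 yields a subgroup of order \<open>p\<close>; Lagrange's theorem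
  in it gives the power.\<close>

lemma (in group) ex_order_prime_element:
  assumes "finite (carrier G)" "prime p" "p dvd Coset.order G"
  shows "\<exists>x\<in>carrier G. x \<noteq> \<one> \<and> x [^] p = \<one>"
proof -
  obtain m where m: "Coset.order G = p ^ 1 * m" using assms(3) by auto
  from sylow_thm[OF assms(2) is_group m assms(1)]
  obtain K where K: "subgroup K G" "card K = p" by auto
  interpret K: subgroup K G by (rule K(1))
  have "\<not> K \<subseteq> {\<one>}"
    using K(2) prime_gt_1_nat[OF assms(2)] card_mono[of "{\<one>}" K] by fastforce
  then obtain x where x: "x \<in> K" "x \<noteq> \<one>" by auto
  have "x [^]\<^bsub>G\<lparr>carrier := K\<rparr>\<^esub> Coset.order (G\<lparr>carrier := K\<rparr>) = \<one>\<^bsub>G\<lparr>carrier := K\<rparr>\<^esub>"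
    by (rule group.pow_order_eq_1) (use x subgroup_imp_group[OF K(1)] in auto)
  then have "x [^] p = \<one>"
    using K(2) by (simp add: Coset.order_def nat_pow_def)
  then show ?thesis using x by auto
qed

lemma fin_graph_edge_subset: "fin_graph G \<Longrightarrow> e \<in> edges G \<Longrightarrow> e \<subseteq> verts G"
  by (auto simp: fin_graph_def)

text \<open>An injective homomorphism is injective on vertices and on edges. If \<open>H\<close> has
  no more of either than \<open>G\<close>, both maps are onto by finiteness, and then edges are
  reflected as well.\<close>

lemma
  assumes G: "fin_graph G" and H: "fin_graph H" and g: "g \<in> inj_homs G H"
  shows card_verts_le_of_inj_homs: "card (verts G) \<le> card (verts H)"
    and card_edges_le_of_inj_homs: "card (edges G) \<le> card (edges H)"
    and graph_iso_of_inj_homs: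
      "card (verts H) \<le> card (verts G) \<Longrightarrow> card (edges H) \<le> card (edges G) \<Longrightarrow> graph_iso g G H"
proof -
  have inj: "inj_on g (verts G)" and gh: "g \<in> homs G H" using g by (auto simp: inj_homs_def)
  have im: "g ` verts G \<subseteq> verts H" using homs_PiE[OF gh] by auto
  have fin: "finite (verts H)" "finite (edges H)" using H by (auto simp: fin_graph_def finite_edges)
  show "card (verts G) \<le> card (verts H)" by (rule card_inj_on_le[OF inj im fin(1)])
  have injE: "inj_on ((`) g) (edges G)"
    using fin_graph_edge_subset[OF G] by (auto intro!: inj_onI simp: inj_on_image_eq_iff[OF inj])
  have imE: "(`) g ` edges G \<subseteq> edges H"
  proof safe
    fix e assume e: "e \<in> edges G"
    with G obtain u v where uv: "u \<in> verts G" "v \<in> verts G" "e = {u, v}"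
      by (auto simp: fin_graph_def)
    then show "g ` e \<in> edges H" using homs_edge[OF gh uv(1,2)] e by simp
  qed
  show "card (edges G) \<le> card (edges H)" by (rule card_inj_on_le[OF injE imE fin(2)])
  assume V: "card (verts H) \<le> card (verts G)" and E: "card (edges H) \<le> card (edges G)"
  have "g ` verts G = verts H"
    by (rule card_seteq[OF fin(1) im]) (simp add: card_image inj V)
  moreover have eqE: "(`) g ` edges G = edges H"
    by (rule card_seteq[OF fin(2) imE]) (simp add: card_image injE E)
  \<comment> \<open>By surjectivity on edges the edge of \<open>H\<close> is the image of some edge
    \<open>e\<close>, and injectivity on vertices forces \<open>e = {u, v}\<close>.\<close>
  have "{u, v} \<in> edges G" if "u \<in> verts G" "v \<in> verts G" "{g u, g v} \<in> edges H" for u v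
  proof -
    from that(3) eqE have "g ` {u, v} \<in> (`) g ` edges G" by simp
    then obtain e where e: "e \<in> edges G" "g ` e = g ` {u, v}" by (metis imageE)
    then have "e = {u, v}"
      using inj_on_image_eq_iff[OF inj, of e "{u, v}"] fin_graph_edge_subset[OF G e(1)] that by simp
    then show ?thesis using e by simp
  qed
  ultimately show "graph_iso g G H"
    using inj homs_edge[OF gh] by (auto simp: graph_iso_def bij_betw_def)
qed

text \<open>Both counts can only grow along an injective homomorphism, so comparing their sums
  forces equality in each. One numerical size therefore suffices to order the matrix.\<close>

lemma isomorphic_of_inj_homs:
  assumes "fin_graph G" "fin_graph H" "inj_homs G H \<noteq> {}"
    and "card (verts H) + card (edges H) \<le> card (verts G) + card (edges G)"
  shows "isomorphic G H"
proof -
  from assms(3) obtain g where g: "g \<in> inj_homs G H" by auto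
  show ?thesis
    using assms(4) card_verts_le_of_inj_homs[OF assms(1,2) g] card_edges_le_of_inj_homs[OF assms(1,2) g]
      graph_iso_of_inj_homs[OF assms(1,2) g] by (auto simp: isomorphic_def)
qed

text \<open>An injective endomorphism of a finite graph is an isomorphism. The bijection only
  exchanges the default values outside \<open>verts G\<close>, \<open>undefined\<close> against the
  identity.\<close>

lemma card_inj_homs_self:
  assumes G: "fin_graph G"
  shows "card (inj_homs G G) = card {f. automorphism f G}"
proof -
  let ?V = "verts G"
  let ?ext = "\<lambda>g x. if x \<in> ?V then g x else x"
  have "bij_betw (\<lambda>f. restrict f ?V) {f. automorphism f G} (inj_homs G G)"
  proof (rule bij_betw_byWitness[where f' = ?ext])
    show "\<forall>f\<in>{f. automorphism f G}. ?ext (restrict f ?V) = f"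
      by (auto simp: automorphism_def permutes_def fun_eq_iff)
    show "\<forall>g\<in>inj_homs G G. restrict (?ext g) ?V = g"
      by (auto simp: inj_homs_def homs_def fun_eq_iff PiE_def extensional_def)
    show "(\<lambda>f. restrict f ?V) ` {f. automorphism f G} \<subseteq> inj_homs G G"
      by (auto simp: automorphism_def inj_homs_def homs_def graph_iso_def bij_betw_def)
    show "?ext ` inj_homs G G \<subseteq> {f. automorphism f G}"
    proof safe
      fix g assume "g \<in> inj_homs G G"
      then have g: "graph_iso g G G" using graph_iso_of_inj_homs[OF G G] by simp
      then have b: "bij_betw g ?V ?V" by (simp add: graph_iso_def)
      have b': "bij_betw (?ext g) ?V ?V \<longleftrightarrow> bij_betw g ?V ?V" by (rule bij_betw_cong) simp
      have "?ext g permutes ?V" by (rule bij_imp_permutes) (use b b' in auto)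
      moreover have "graph_iso (?ext g) G G" using g b b' by (simp add: graph_iso_def)
      ultimately show "automorphism (?ext g) G" by (simp add: automorphism_def)
    qed
  qed
  then show ?thesis by (metis bij_betw_same_card)
qed

text \<open>Automorphisms fix everything outside \<open>verts G\<close>, so \<open>id\<close> is the
  unit and group powers are the iterates that occur in \<open>order_reduced\<close>.\<close>

definition aut_group :: "'a graph \<Rightarrow> ('a \<Rightarrow> 'a) monoid" where
  "aut_group G = \<lparr>carrier = {f. automorphism f G}, monoid.mult = (\<circ>), one = id\<rparr>"

lemma group_aut_group: "group (aut_group G)"
proof (rule groupI)
  fix f g assume "f \<in> carrier (aut_group G)" "g \<in> carrier (aut_group G)"
  then show "f \<otimes>\<^bsub>aut_group G\<^esub> g \<in> carrier (aut_group G)"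
    by (simp add: aut_group_def automorphism_def graph_iso_comp[of _ G G] permutes_compose)
next
  show "\<one>\<^bsub>aut_group G\<^esub> \<in> carrier (aut_group G)"
    by (simp add: aut_group_def automorphism_def graph_iso_def permutes_id)
next
  fix f assume "f \<in> carrier (aut_group G)"
  then have f: "f permutes verts G" "graph_iso f G G" by (auto simp: aut_group_def automorphism_def)
  have i: "Hilbert_Choice.inv f permutes verts G" by (rule permutes_inv[OF f(1)])
  have "graph_iso (Hilbert_Choice.inv f) G G"
    unfolding graph_iso_def
  proof (intro conjI ballI)
    show "bij_betw (Hilbert_Choice.inv f) (verts G) (verts G)" by (rule permutes_imp_bij[OF i])
    fix u v assume uv: "u \<in> verts G" "v \<in> verts G"
    have "Hilbert_Choice.inv f u \<in> verts G" "Hilbert_Choice.inv f v \<in> verts G"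
      using uv permutes_in_image[OF i] by auto
    then show "{u, v} \<in> edges G \<longleftrightarrow> {Hilbert_Choice.inv f u, Hilbert_Choice.inv f v} \<in> edges G"
      using f(2) permutes_inverses(1)[OF f(1)] by (simp add: graph_iso_def)
  qed
  then show "\<exists>g\<in>carrier (aut_group G). g \<otimes>\<^bsub>aut_group G\<^esub> f = \<one>\<^bsub>aut_group G\<^esub>"
    using i permutes_inv_o(2)[OF f(1)] by (auto simp: aut_group_def automorphism_def)
qed (auto simp: aut_group_def comp_assoc)

lemma aut_group_pow: "f [^]\<^bsub>aut_group G\<^esub> (n :: nat) = f ^^ n"
  by (induction n) (simp_all add: nat_pow_def aut_group_def funpow_Suc_right del: funpow.simps(2))

lemma not_dvd_card_inj_homs_self:
  assumes "fin_graph G" "prime p" "order_reduced p G"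
  shows "\<not> p dvd card (inj_homs G G)"
proof
  assume "p dvd card (inj_homs G G)"
  then have "p dvd Coset.order (aut_group G)"
    by (simp add: card_inj_homs_self[OF assms(1)] Coset.order_def aut_group_def)
  moreover have "finite (carrier (aut_group G))"
    using assms(1) finite_permutations[of "verts G"]
    by (auto simp: aut_group_def automorphism_def fin_graph_def intro: finite_subset[rotated])
  ultimately obtain f where "automorphism f G" "f \<noteq> id" "f ^^ p = id"
    using group.ex_order_prime_element[OF group_aut_group, of G p] assms(2)
    by (auto simp: aut_group_pow) (auto simp: aut_group_def)
  then show False using assms(3) by (auto simp: order_reduced_def)
qed

subsection \<open>Combinations of homomorphism counts modulo a prime\<close>

text \<open>Modulo \<open>p\<close>, this is the span of the functions \<open>hom G\<close>
  restricted to \<open>X\<close>: the coefficients are the same for all \<open>H\<close>, and values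
  outside \<open>X\<close> are ignored.\<close>

definition hom_span :: "nat \<Rightarrow> nat graph set \<Rightarrow> 'a graph set \<Rightarrow> ('a graph \<Rightarrow> int) set" where
  "hom_span p R X = {\<phi>. \<exists>a. \<forall>H\<in>X. [\<phi> H = (\<Sum>G\<in>R. a G * int (hom G H))] (mod int p)}"

lemma hom_span_hom:
  assumes "finite R" "G \<in> R"
  shows "(\<lambda>H. int (hom G H)) \<in> hom_span p R X"
proof -
  have "(\<Sum>G'\<in>R. (if G' = G then 1 else 0) * int (hom G' H)) = int (hom G H)" for H :: "'a graph"
    using assms by (simp add: if_distrib[of "\<lambda>x. x * _"] cong: if_cong)
  then show ?thesis
    unfolding hom_span_def by (auto intro!: exI[of _ "\<lambda>G'. if G' = G then 1 else 0"])
qed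

lemma hom_span_cong:
  assumes "\<phi> \<in> hom_span p R X" "\<And>H. H \<in> X \<Longrightarrow> [\<psi> H = \<phi> H] (mod int p)"
  shows "\<psi> \<in> hom_span p R X"
  using assms unfolding hom_span_def by (blast intro: cong_trans)

lemma hom_span_zero: "(\<lambda>_. 0) \<in> hom_span p R X"
  unfolding hom_span_def by (auto intro!: exI[of _ "\<lambda>_. 0"])

lemma hom_span_add_scale:
  assumes "\<phi> \<in> hom_span p R X" "\<psi> \<in> hom_span p R X"
  shows "(\<lambda>H. \<phi> H + c * \<psi> H) \<in> hom_span p R X"
proof -
  from assms obtain a b where
    a: "\<And>H. H \<in> X \<Longrightarrow> [\<phi> H = (\<Sum>G\<in>R. a G * int (hom G H))] (mod int p)" and
    b: "\<And>H. H \<in> X \<Longrightarrow> [\<psi> H = (\<Sum>G\<in>R. b G * int (hom G H))] (mod int p)"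
    unfolding hom_span_def by blast
  have "[\<phi> H + c * \<psi> H = (\<Sum>G\<in>R. (a G + c * b G) * int (hom G H))] (mod int p)"
    if "H \<in> X" for H
    using cong_add[OF a[OF that] cong_scalar_left[OF b[OF that], of c]]
    by (simp add: sum_distrib_left distrib_right sum.distrib mult.assoc)
  then show ?thesis unfolding hom_span_def by (intro CollectI exI) auto
qed

lemma hom_span_add_sum:
  assumes "finite I" "\<phi> \<in> hom_span p R X" "\<And>i. i \<in> I \<Longrightarrow> \<psi> i \<in> hom_span p R X"
  shows "(\<lambda>H. \<phi> H + (\<Sum>i\<in>I. c i * \<psi> i H)) \<in> hom_span p R X"
  using assms(1,3)
proof (induction I rule: finite_induct)
  case (insert i I)
  then have "(\<lambda>H. (\<phi> H + (\<Sum>i\<in>I. c i * \<psi> i H)) + c i * \<psi> i H) \<in> hom_span p R X"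
    by (intro hom_span_add_scale) auto
  then show ?case using insert by (simp add: add_ac)
qed (simp add: assms(2))

text \<open>Solve the fibre decomposition of \<open>hom G\<close> for the term of the identity
  pattern. All other quotients have fewer vertices, so they stay below \<open>N\<close> and one set
  \<open>R\<close> serves the whole induction.\<close>

lemma inj_homs_in_hom_span:
  fixes G :: "nat graph"
  assumes R: "finite R" "\<And>G :: nat graph. fin_graph G \<Longrightarrow> card (verts G) \<le> N \<Longrightarrow> \<exists>G'\<in>R. isomorphic G G'"
    and X: "\<And>H. H \<in> X \<Longrightarrow> fin_graph H"
    and G: "fin_graph G" "card (verts G) \<le> N"
  shows "(\<lambda>H. int (card (inj_homs G H))) \<in> hom_span p R X"
  using G
proof (induction "card (verts G)" arbitrary: G rule: less_induct)
  case less
  let ?K = "ker_maps (verts G) - {restrict id (verts G)}"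
  have finV: "finite (verts G)" using less.prems by (simp add: fin_graph_def)
  then have finK: "finite (ker_maps (verts G))"
    by (auto simp: ker_maps_def intro!: finite_PiE)
  from R(2)[OF less.prems] obtain G' where G': "G' \<in> R" "isomorphic G G'" by auto
  then have "(\<lambda>H. int (hom G H)) \<in> hom_span p R X"
    using hom_span_hom[OF R(1) G'(1)] by (simp add: hom_isomorphic[OF G'(2)])
  moreover have "(\<lambda>H. int (card (inj_homs (quotient_graph G k) H))) \<in> hom_span p R X" if "k \<in> ?K" for k
    using card_verts_quotient_less[OF finV, of k] that less.prems
    by (intro less.hyps) (auto simp: fin_graph_quotient_graph)
  ultimately have "(\<lambda>H. int (hom G H) + (\<Sum>k\<in>?K. (-1) * int (card (inj_homs (quotient_graph G k) H))))
      \<in> hom_span p R X"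
    by (intro hom_span_add_sum) (use finK in auto)
  then show ?case
  proof (rule hom_span_cong)
    fix H assume "H \<in> X"
    then have "hom G H = card (inj_homs G H) + (\<Sum>k\<in>?K. card (inj_homs (quotient_graph G k) H))"
      using hom_eq_sum_inj_homs[OF less.prems(1) X]
        sum.remove[OF finK restrict_id_in_ker_maps, of "\<lambda>k. card (inj_homs (quotient_graph G k) H)"]
      by (simp add: quotient_restrict_id[OF less.prems(1)])
    then show "[int (card (inj_homs G H)) =
      int (hom G H) + (\<Sum>k\<in>?K. (-1) * int (card (inj_homs (quotient_graph G k) H)))] (mod int p)"
      by (simp add: sum_negf)
  qed
qed

section \<open>Indicator functions by inverting a triangular matrix modulo p\<close>

lemma ex_isomorphic_nat_graph:
  assumes G: "fin_graph G"
  obtains G' :: "nat graph"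
  where "fin_graph G'" "isomorphic G G'" "verts G' = {..<card (verts G)}"
proof -
  have "finite (verts G)" using G by (simp add: fin_graph_def)
  from ex_bij_betw_finite_nat[OF this] obtain f where
    f: "bij_betw f (verts G) {..<card (verts G)}" by (auto simp: lessThan_atLeast0)
  then have inj: "inj_on f (verts G)" by (simp add: bij_betw_def)
  let ?G = "\<lparr>verts = f ` verts G, edges = (`) f ` edges G\<rparr>"
  have "{u, v} \<in> edges G" if "u \<in> verts G" "v \<in> verts G" "{f u, f v} \<in> (`) f ` edges G" for u v
  proof -
    from that(3) have "f ` {u, v} \<in> (`) f ` edges G" by simp
    then obtain e where e: "e \<in> edges G" "f ` e = f ` {u, v}" by (metis imageE)
    then have "e = {u, v}"
      using inj_on_image_eq_iff[OF inj, of e "{u, v}"] fin_graph_edge_subset[OF G e(1)] that by simp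
    then show ?thesis using e by simp
  qed
  moreover have "{f u, f v} \<in> (`) f ` edges G" if "{u, v} \<in> edges G" for u v
    using imageI[OF that, of "(`) f"] by simp
  ultimately have "graph_iso f G ?G"
    using inj by (auto simp: graph_iso_def bij_betw_def)
  moreover have "fin_graph ?G" using G by (fastforce simp: fin_graph_def)
  ultimately show thesis
    using f by (intro that[of ?G]) (auto simp: isomorphic_def bij_betw_def)
qed

lemma indicator_in_hom_span:
  fixes X :: "'a graph set"
  assumes R: "finite R" "\<And>G :: nat graph. fin_graph G \<Longrightarrow> card (verts G) \<le> N \<Longrightarrow> \<exists>G'\<in>R. isomorphic G G'"
    and p: "prime p" and finX: "finite X"
    and X: "\<And>H. H \<in> X \<Longrightarrow> fin_graph H" "\<And>H. H \<in> X \<Longrightarrow> order_reduced p H"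
      "\<And>H. H \<in> X \<Longrightarrow> card (verts H) \<le> N"
    and noniso: "\<And>H H'. H \<in> X \<Longrightarrow> H' \<in> X \<Longrightarrow> isomorphic H H' \<Longrightarrow> H = H'"
    and K: "K \<in> X"
  shows "(\<lambda>H. if H = K then 1 else 0) \<in> hom_span p R X"
proof -
  let ?m = "\<lambda>H. card (verts H) + card (edges H)"
  \<comment> \<open>The induction descends from the largest graphs; the bound makes
    \<open>B - ?m K\<close> strictly smaller for larger graphs despite truncated
    subtraction.\<close>
  define B where "B = Max (?m ` X)"
  have B: "?m H \<le> B" if "H \<in> X" for H
    unfolding B_def by (rule Max_ge) (use finX that in auto)
  show ?thesis
    using K
  proof (induction "B - ?m K" arbitrary: K rule: less_induct)
    case (less K)
    let ?inj = "\<lambda>H. int (card (inj_homs K H))"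
    let ?Y = "{H \<in> X. ?m K < ?m H}"
    have finK: "fin_graph K" by (rule X(1)[OF less.prems])
    \<comment> \<open>Constituents have vertices in \<open>nat\<close>, while those of
      \<open>K\<close> have arbitrary type.\<close>
    obtain K' :: "nat graph" where K': "fin_graph K'" "isomorphic K K'" "verts K' = {..<card (verts K)}"
      using ex_isomorphic_nat_graph[OF finK] .
    have "(\<lambda>H. int (card (inj_homs K' H))) \<in> hom_span p R X"
      by (rule inj_homs_in_hom_span[OF R]) (use K' X less.prems in auto)
    then have inj: "?inj \<in> hom_span p R X"
      by (simp add: card_inj_homs_isomorphic[OF K'(2)])
    (* back substitution in the triangular matrix *)
    have "(\<lambda>H. if H = H' then 1 else 0) \<in> hom_span p R X" if "H' \<in> ?Y" for H'
      using that B[of H'] by (intro less.hyps) auto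
    then have "(\<lambda>H. ?inj H + (\<Sum>H'\<in>?Y. (- ?inj H') * (if H = H' then 1 else 0))) \<in> hom_span p R X"
      using finX inj by (intro hom_span_add_sum) auto
    moreover have "?inj H + (\<Sum>H'\<in>?Y. (- ?inj H') * (if H = H' then 1 else 0))
        = ?inj K * (if H = K then 1 else 0)" if "H \<in> X" for H
    proof -
      have "(\<Sum>H'\<in>?Y. (- ?inj H') * (if H = H' then 1 else 0))
          = (\<Sum>H'\<in>?Y. if H = H' then - ?inj H' else 0)"
        by (rule sum.cong) auto
      also have "\<dots> = (if H \<in> ?Y then - ?inj H else 0)"
        by (rule sum.delta') (use finX in simp)
      finally have "(\<Sum>H'\<in>?Y. (- ?inj H') * (if H = H' then 1 else 0))
          = (if H \<in> ?Y then - ?inj H else 0)" .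
      \<comment> \<open>Equal size is included here: an injective homomorphism would then be an
        isomorphism, and distinct members of \<open>X\<close> are not isomorphic.\<close>
      moreover have "inj_homs K H = {}" if "H \<noteq> K" "\<not> ?m K < ?m H"
        using isomorphic_of_inj_homs[OF finK X(1)[OF \<open>H \<in> X\<close>]] noniso[OF less.prems \<open>H \<in> X\<close>] that[unfolded not_less]
        by blast
      ultimately show ?thesis using that by auto
    qed
    ultimately have span: "(\<lambda>H. ?inj K * (if H = K then 1 else 0)) \<in> hom_span p R X"
      by (elim hom_span_cong) simp
    have "coprime (?inj K) (int p)"
      using not_dvd_card_inj_homs_self[OF finK p X(2)[OF less.prems]] p
      by (metis coprime_commute coprime_int_iff prime_imp_coprime)
    \<comment> \<open>The diagonal entry is inverted modulo \<open>p\<close>; this is the place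
      where the reducedness of \<open>K\<close> enters.\<close>
    then obtain d where d: "[?inj K * d = 1] (mod int p)"
      using cong_solve_coprime_int by blast
    have "(\<lambda>H. 0 + d * (?inj K * (if H = K then 1 else 0))) \<in> hom_span p R X"
      by (rule hom_span_add_scale[OF hom_span_zero span])
    then show ?case
      by (rule hom_span_cong) (use d in \<open>auto simp: mult.commute cong_sym_eq\<close>)
  qed
qed

section \<open>Representatives of the graphs with at most N vertices\<close>

lemma ex_nat_graph_representatives:
  obtains R :: "nat graph set"
  where "finite R" "card R \<le> 2 ^ (N + N * N)" "\<forall>G\<in>R. fin_graph G"
    "\<forall>G\<in>R. \<forall>G'\<in>R. isomorphic G G' \<longrightarrow> G = G'"
    "\<forall>G :: nat graph. fin_graph G \<longrightarrow> card (verts G) \<le> N \<longrightarrow> (\<exists>G'\<in>R. isomorphic G G')"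
proof -
  \<comment> \<open>The intersection discards pairs outside the vertex set, so one power set of
    codes serves all \<open>n\<close> up to \<open>N\<close> and the codes are easy to
    count.\<close>
  define mk :: "nat \<times> (nat \<times> nat) set \<Rightarrow> nat graph" where
    "mk = (\<lambda>(n, S). \<lparr>verts = {..<n}, edges = (\<lambda>(u, v). {u, v}) ` (S \<inter> {..<n} \<times> {..<n})\<rparr>)"
  define I where "I = {..N} \<times> Pow ({..<N} \<times> {..<N})"
  define rep where "rep G = (SOME G'. G' \<in> mk ` I \<and> isomorphic G G')" for G :: "nat graph"
  have finI: "finite I" by (simp add: I_def)
  have rep: "rep G \<in> mk ` I \<and> isomorphic G (rep G)" if "\<exists>G'\<in>mk ` I. isomorphic G G'" for G
    unfolding rep_def by (rule someI_ex) (use that in blast)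
  have rep_mk: "rep G \<in> mk ` I \<and> isomorphic G (rep G)" if "G \<in> mk ` I" for G
    using rep that isomorphic_refl by blast
  \<comment> \<open>Isomorphic graphs give \<open>SOME\<close> the same predicate, so the chosen
    representatives are equal and not just isomorphic.\<close>
  have rep_cong: "rep G = rep G'" if "isomorphic G G'" for G G'
  proof -
    have "isomorphic G L \<longleftrightarrow> isomorphic G' L" for L :: "nat graph"
      using isomorphic_trans[OF that] isomorphic_trans[OF isomorphic_sym[OF that]] by blast
    then show ?thesis by (simp add: rep_def)
  qed
  show thesis
  proof (rule that[of "rep ` mk ` I"]; (intro allI ballI impI)?)
    show "finite (rep ` mk ` I)" using finI by simp
    have "card (rep ` mk ` I) \<le> card I"
      using finI by (meson card_image_le finite_imageI le_trans)
    also have "card I = Suc N * 2 ^ (N * N)"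
      by (simp add: I_def card_cartesian_product card_Pow)
    \<comment> \<open>The factor \<open>N + 1\<close> is absorbed by \<open>2 ^ N\<close> to leave a
      single power of two.\<close>
    also have "\<dots> \<le> 2 ^ N * 2 ^ (N * N)"
      by (intro mult_right_mono) (simp_all add: Suc_leI less_exp)
    finally show "card (rep ` mk ` I) \<le> 2 ^ (N + N * N)" by (simp add: power_add)
    show "fin_graph G" if "G \<in> rep ` mk ` I" for G
    proof -
      have "G \<in> mk ` I" using that rep_mk by auto
      then show ?thesis by (force simp: mk_def fin_graph_def)
    qed
    show "G = G'" if GG': "G \<in> rep ` mk ` I" "G' \<in> rep ` mk ` I" "isomorphic G G'" for G G'
    proof -
      from GG' obtain L L' where L: "L \<in> mk ` I" "G = rep L" "L' \<in> mk ` I" "G' = rep L'" by blast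
      have "isomorphic L L'"
        using isomorphic_trans[OF isomorphic_trans isomorphic_sym, of L "rep L" "rep L'" L']
          L rep_mk GG'(3) by simp
      then show ?thesis using L rep_cong by simp
    qed
    show "\<exists>G'\<in>rep ` mk ` I. isomorphic G G'" if G: "fin_graph G" "card (verts G) \<le> N" for G :: "nat graph"
    proof -
      let ?n = "card (verts G)"
      obtain L :: "nat graph" where L: "fin_graph L" "isomorphic G L" "verts L = {..<?n}"
        using ex_isomorphic_nat_graph[OF G(1)] .
      let ?S = "{(u, v). u < ?n \<and> v < ?n \<and> {u, v} \<in> edges L}"
      have "edges L = (\<lambda>(u, v). {u, v}) ` (?S \<inter> {..<?n} \<times> {..<?n})"
      proof (intro equalityI subsetI)
        fix e assume "e \<in> edges L"
        moreover from this obtain u v where "u < ?n" "v < ?n" "e = {u, v}"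
          using L by (auto simp: fin_graph_def)
        ultimately show "e \<in> (\<lambda>(u, v). {u, v}) ` (?S \<inter> {..<?n} \<times> {..<?n})"
          by (auto intro!: image_eqI[of _ _ "(u, v)"])
      qed auto
      then have "L = mk (?n, ?S)" using L by (simp add: mk_def)
      moreover have "(?n, ?S) \<in> I" using G(2) by (auto simp: I_def)
      ultimately have "L \<in> mk ` I" by blast
      then show ?thesis using rep_mk isomorphic_trans[OF L(2)] by blast
    qed
  qed
qed

text \<open>Reducing the coefficients to residues changes the sum only by multiples of
  \<open>p\<close>. Those that become 0 drop out, so the constituents lie in \<open>R\<close> and
  inherit finiteness and pairwise non-isomorphism.\<close>

lemma ex_qgraph_of_hom_span:
  assumes p: "p > 0" and R: "finite R" "\<And>G. G \<in> R \<Longrightarrow> fin_graph G"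
    "\<And>G G'. G \<in> R \<Longrightarrow> G' \<in> R \<Longrightarrow> isomorphic G G' \<Longrightarrow> G = G'"
    and \<phi>: "\<phi> \<in> hom_span p R X"
  obtains F where "quantum_graph p F" "card (constituents F) \<le> card R"
    "\<forall>H\<in>X. [qhom F H = \<phi> H] (mod int p)"
proof -
  from \<phi> obtain a where a: "\<And>H. H \<in> X \<Longrightarrow> [\<phi> H = (\<Sum>G\<in>R. a G * int (hom G H))] (mod int p)"
    unfolding hom_span_def by blast
  define F :: qgraph where "F = Abs_poly_mapping (\<lambda>G. a G mod int p when G \<in> R)"
  have lookup: "Poly_Mapping.lookup F G = (a G mod int p when G \<in> R)" for G
  proof -
    have "{G. (a G mod int p when G \<in> R) \<noteq> 0} \<subseteq> R"
      by (auto intro: ccontr)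
    then have "finite {G. (a G mod int p when G \<in> R) \<noteq> 0}"
      using R(1) by (rule finite_subset)
    then show ?thesis unfolding F_def by (simp add: lookup_Abs_poly_mapping)
  qed
  have sub: "constituents F \<subseteq> R"
    by (auto simp: constituents_def lookup in_keys_iff intro: ccontr)
  have "quantum_graph p F"
    using sub R p by (fastforce simp: quantum_graph_def lookup when_def)
  moreover have "card (constituents F) \<le> card R"
    by (rule card_mono[OF R(1) sub])
  moreover have "[qhom F H = \<phi> H] (mod int p)" if "H \<in> X" for H
  proof -
    have "qhom F H = (\<Sum>G\<in>R. Poly_Mapping.lookup F G * int (hom G H))"
      unfolding qhom_def by (rule sum.mono_neutral_left[OF R(1) sub]) (simp add: constituents_def in_keys_iff)
    also have "\<dots> = (\<Sum>G\<in>R. (a G mod int p) * int (hom G H))"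
      by (simp add: lookup)
    also have "[\<dots> = (\<Sum>G\<in>R. a G * int (hom G H))] (mod int p)"
      by (intro cong_sum cong_mult cong_mod_left) auto
    finally show ?thesis using a[OF that] cong_sym cong_trans by blast
  qed
  ultimately show thesis by (intro that) auto
qed

theorem theorem3p6:
  "\<exists>c :: nat poly. \<forall>(p :: nat) (r :: nat) (H :: nat \<Rightarrow> 'a graph).
     prime p \<longrightarrow>
     (\<forall>i\<in>{1..r}. fin_graph (H i) \<and> order_reduced p (H i)) \<longrightarrow>
     (\<forall>i\<in>{1..r}. \<forall>j\<in>{1..r}. i \<noteq> j \<longrightarrow> \<not> isomorphic (H i) (H j)) \<longrightarrow>
     (\<exists>F :: nat \<Rightarrow> qgraph.
        (\<forall>i\<in>{1..r}. quantum_graph p (F i) \<and>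
           card (constituents (F i)) \<le> 2 ^ poly c (MAX k\<in>{1..r}. card (verts (H k)))) \<and>
        (\<forall>i\<in>{1..r}. \<forall>j\<in>{1..r}.
           (i = j \<longrightarrow> [qhom (F i) (H j) = 1] (mod int p)) \<and>
           (i \<noteq> j \<longrightarrow> [qhom (F i) (H j) = 0] (mod int p))))"
\<comment> \<open>The polynomial \<open>x + x^2\<close> is the exponent in the bound on the number
  of representatives.\<close>
proof (intro exI[of _ "[:0, 1, 1:]"] allI impI)
  fix p r :: nat and H :: "nat \<Rightarrow> 'a graph"
  assume p: "prime p"
    and H: "\<forall>i\<in>{1..r}. fin_graph (H i) \<and> order_reduced p (H i)"
    and noniso: "\<forall>i\<in>{1..r}. \<forall>j\<in>{1..r}. i \<noteq> j \<longrightarrow> \<not> isomorphic (H i) (H j)"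
  \<comment> \<open>For \<open>r = 0\<close> this is an unspecified maximum of the empty set, but
    then there is no index to consider.\<close>
  define N where "N = (MAX k\<in>{1..r}. card (verts (H k)))"
  have N: "card (verts (H i)) \<le> N" if "i \<in> {1..r}" for i
    unfolding N_def using that by (intro Max_ge) auto
  obtain R :: "nat graph set" where R: "finite R" "card R \<le> 2 ^ (N + N * N)"
    "\<forall>G\<in>R. fin_graph G"
    "\<forall>G\<in>R. \<forall>G'\<in>R. isomorphic G G' \<longrightarrow> G = G'"
    "\<forall>G :: nat graph. fin_graph G \<longrightarrow> card (verts G) \<le> N \<longrightarrow> (\<exists>G'\<in>R. isomorphic G G')"
    by (rule ex_nat_graph_representatives[of N])
  let ?X = "H ` {1..r}"
  have "\<exists>F. quantum_graph p F \<and> card (constituents F) \<le> 2 ^ (N + N * N) \<and>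
      (\<forall>j\<in>{1..r}. [qhom F (H j) = (if H j = H i then 1 else 0)] (mod int p))"
    if i: "i \<in> {1..r}" for i
  proof -
    have span: "(\<lambda>K. if K = H i then 1 else 0) \<in> hom_span p R ?X"
    proof (rule indicator_in_hom_span[OF R(1) R(5)[rule_format] p])
      show "K = K'" if KK': "K \<in> ?X" "K' \<in> ?X" "isomorphic K K'" for K K'
      proof -
        from KK' obtain j k where "j \<in> {1..r}" "k \<in> {1..r}" "K = H j" "K' = H k" by blast
        then show ?thesis using noniso KK'(3) by (cases "j = k") auto
      qed
    qed (use H N i in auto)
    obtain F where "quantum_graph p F" "card (constituents F) \<le> card R"
      "\<forall>K\<in>?X. [qhom F K = (if K = H i then 1 else 0)] (mod int p)"
      by (rule ex_qgraph_of_hom_span[OF prime_gt_0_nat[OF p] R(1) R(3,4)[rule_format] span])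
    then show ?thesis using R(2) by (intro exI[of _ F]) auto
  qed
  then obtain F where F: "\<And>i. i \<in> {1..r} \<Longrightarrow> quantum_graph p (F i)"
    "\<And>i. i \<in> {1..r} \<Longrightarrow> card (constituents (F i)) \<le> 2 ^ (N + N * N)"
    "\<And>i j. i \<in> {1..r} \<Longrightarrow> j \<in> {1..r} \<Longrightarrow>
       [qhom (F i) (H j) = (if H j = H i then 1 else 0)] (mod int p)"
    by metis
  \<comment> \<open>The indicators compare graphs, the claim compares indices; they agree because a
    graph is isomorphic to itself.\<close>
  have "H j \<noteq> H i" if "i \<in> {1..r}" "j \<in> {1..r}" "i \<noteq> j" for i j
    using noniso that isomorphic_refl by metis
  then have "[qhom (F i) (H j) = (if i = j then 1 else 0)] (mod int p)"
    if "i \<in> {1..r}" "j \<in> {1..r}" for i j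
    using F(3)[OF that] that by (cases "i = j") auto
  then show "\<exists>F :: nat \<Rightarrow> qgraph.
        (\<forall>i\<in>{1..r}. quantum_graph p (F i) \<and>
           card (constituents (F i)) \<le> 2 ^ poly [:0, 1, 1:] (MAX k\<in>{1..r}. card (verts (H k)))) \<and>
        (\<forall>i\<in>{1..r}. \<forall>j\<in>{1..r}.
           (i = j \<longrightarrow> [qhom (F i) (H j) = 1] (mod int p)) \<and>
           (i \<noteq> j \<longrightarrow> [qhom (F i) (H j) = 0] (mod int p)))"
    using F(1,2) unfolding N_def[symmetric]
    by (intro exI[of _ F]) (fastforce simp: algebra_simps)
qed

end
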